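(* Let $c\ge1$ and $N\ge 2$ be integers, and let $\mathcal{P}$ be a finite bias distribution with possible outputs $p_0<p_1<\dots<p_k$. Let $\delta\ge 0$ and let $U_0,\dots,U_k$ be reals with $|U_i-\sigma(p_i)|\le\delta$ for all $i$. Let $\mathcal{R}>0$ satisfy $\mathcal{R}\le\min_{1\le\ell\le c}\mathcal{R}_{\ell,\mathcal{P}}$; let $\psi_1,\psi_2>0$ satisfy $\psi_1\le\sigma(p_0)\le\psi_2$; let $\eta_1,\eta_2>0$; let $x_1,x_2>0$ satisfy $x_i\,r(x_i)\le\eta_i\mathcal{R}\psi_1/c$ for $i=1,2$; and let $\varepsilon_1,\varepsilon_2\in(0,1)$. Assume $D:=(1-\eta_1-\eta_2/c)\mathcal{R}-2\delta c>0$, and choose $A_1,A_2$ with $$A_i\ge\frac{c}{D}\cdot\frac{\psi_2}{x_i}\log\frac{1}{\varepsilon_i}\quad(i=1,2)$$ such that $m:=A_1+A_2$ is a positive integer. Put $$Z=\Bigl(\bigl(1-\tfrac{\eta_2}{c}\bigr)\tfrac{\mathcal{R}}{c}-\delta\Bigr)A_1+\Bigl(\tfrac{\eta_1\mathcal{R}}{c}+\delta\Bigr)A_2.$$ Consider the fingerprinting scheme with $N$ users, code length $m$, bias distribution $\mathcal{P}$, approximated scores $U_0,\dots,U_k$ and threshold $Z$ (described in the context). Then for any number $\ell$ of pirates with $1\le\ell\le c$ and any pirates' strategy, the probability of false-positive is less than $1-(1-\varepsilon_1)^{N-1}$ $(\le(N-1)\varepsilon_1)$ and the probability of false-negative is less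 than $\varepsilon_2$. Consequently the total tracing error probability is at most $(N-1)\varepsilon_1+\varepsilon_2$, which equals $\varepsilon$ when $\varepsilon_1=\varepsilon_2=\varepsilon/N$.
   Context: A finite bias distribution is a probability distribution $\mathcal{P}$ supported on a finite subset of $(0,1)$ that is symmetric (outputs $a$ and $1-a$ with the same probability). $E_p$ is expectation over $p\sim\mathcal{P}$. $\sigma(p)=\sqrt{(1-p)/p}$; $f_{\ell,x}(p)=p^x(1-p)^{\ell-x}(x\sigma(p)-(\ell-x)\sigma(1-p))$; $R_{\ell,x}=\max\{0,E_p[f_{\ell,x}(p)]\}$; $\mathcal{R}_{\ell,\mathcal{P}}=E_p[-f_{\ell,0}(p)]-\sum_{x=1}^{\ell-1}\binom{\ell}{x}R_{\ell,x}$; $r(t)=(e^t-1-t)/t^2$ for $t>0$; $\log$ is the natural logarithm. Scheme: the server draws $p^{(1)},\dots,p^{(m)}$ independently from $\mathcal{P}$ (kept secret), and for each user $u_i$ ($1\le i\le N$) a codeword $w_i\in\{0,1\}^m$ whose bits $w_{i,j}$ are all independent with $\Pr(w_{i,j}=1)=p^{(j)}$. A set of $\ell$ pirates produces a pirated word $y\in\{0,1,?\}^m$ by an arbitrary (possibly randomized) strategy that uses only the pirates' own codewords (and the public description of $\mathcal{P}$), so that $y$ is independent of the innocent users' codewords and, given the pirates' codewords, of the actual values $p^{(j)}$; it must satisfy the Marking Assumption: if all pirates' bits at position $j$ coincide, then $y_j$ equals that common bit. Approximated tracing: let $\nu_j$ be the index with $p^{(j)}=p_{\nu_j}$; user $u_i$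 gets score $\widehat S_i=\sum_{j=1}^m\widehat S_i^{(j)}$ where $\widehat S_i^{(j)}=U_{\nu_j}$ if $(y_j,w_{i,j})=(1,1)$, $-U_{k-\nu_j}$ if $(y_j,w_{i,j})=(1,0)$, and $0$ if $y_j\in\{0,?\}$; the algorithm outputs all users with $\widehat S_i\ge Z$. False-positive: at least one innocent (non-pirate) user is output. False-negative: no pirate is output. Tracing error: false-positive or false-negative. *)

theory Defs
  imports "HOL-Probability.Probability"
begin

definition finite_bias_dist :: "real pmf \<Rightarrow> bool" where
  "finite_bias_dist P \<longleftrightarrow> finite (set_pmf P) \<and> set_pmf P \<subseteq> {0<..<1}
     \<and> (\<forall>a. pmf P (1 - a) = pmf P a)"

definition sigma_fp :: "real \<Rightarrow> real" where
  "sigma_fp p = sqrt ((1 - p) / p)"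

definition f_fp :: "nat \<Rightarrow> nat \<Rightarrow> real \<Rightarrow> real" where
  "f_fp l x p = p ^ x * (1 - p) ^ (l - x)
      * (real x * sigma_fp p - real (l - x) * sigma_fp (1 - p))"

definition R_lx :: "real pmf \<Rightarrow> nat \<Rightarrow> nat \<Rightarrow> real" where
  "R_lx P l x = max 0 (measure_pmf.expectation P (f_fp l x))"

definition R_lP :: "real pmf \<Rightarrow> nat \<Rightarrow> real" where
  "R_lP P l = measure_pmf.expectation P (\<lambda>p. - f_fp l 0 p)
      - (\<Sum>x = 1..l - 1. real (l choose x) * R_lx P l x)"

definition r_fun :: "real \<Rightarrow> real" where
  "r_fun t = (exp t - 1 - t) / t\<^sup>2"

definition bias_index :: "(nat \<Rightarrow> real) \<Rightarrow> nat \<Rightarrow> real \<Rightarrow> nat" where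
  "bias_index p k a = (THE i. i \<le> k \<and> p i = a)"

text \<open>Pirated word symbols: Some True = 1, Some False = 0, None = ?.\<close>

definition approx_score ::
  "(nat \<Rightarrow> real) \<Rightarrow> nat \<Rightarrow> (nat \<Rightarrow> real) \<Rightarrow> nat \<Rightarrow> (nat \<Rightarrow> real)
   \<Rightarrow> (nat \<Rightarrow> nat \<Rightarrow> bool) \<Rightarrow> (nat \<Rightarrow> bool option) \<Rightarrow> nat \<Rightarrow> real" where
  "approx_score p k U m pv w y i =
     (\<Sum>j<m. (case y j of
                Some True \<Rightarrow> (if w i j then U (bias_index p k (pv j))
                              else - U (k - bias_index p k (pv j)))
              | _ \<Rightarrow> 0))"

text \<open>Restriction of the codeword matrix to the pirates' rows (the only input
the pirates' strategy may see).\<close>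
definition pirate_view :: "nat set \<Rightarrow> nat \<Rightarrow> (nat \<Rightarrow> nat \<Rightarrow> bool) \<Rightarrow> nat \<Rightarrow> nat \<Rightarrow> bool" where
  "pirate_view T m w = (\<lambda>i j. if i \<in> T \<and> j < m then w i j else False)"

definition marking_assumption ::
  "nat set \<Rightarrow> nat \<Rightarrow> ((nat \<Rightarrow> nat \<Rightarrow> bool) \<Rightarrow> (nat \<Rightarrow> bool option) pmf) \<Rightarrow> bool" where
  "marking_assumption T m strat \<longleftrightarrow>
     (\<forall>W y j b. y \<in> set_pmf (strat W) \<longrightarrow> j < m \<longrightarrow> (\<forall>i\<in>T. W i j = b) \<longrightarrow> y j = Some b)"

definition scheme_experiment ::
  "real pmf \<Rightarrow> nat \<Rightarrow> nat \<Rightarrow> nat set \<Rightarrow> ((nat \<Rightarrow> nat \<Rightarrow> bool) \<Rightarrow> (nat \<Rightarrow> bool option) pmf)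
   \<Rightarrow> ((nat \<Rightarrow> real) \<times> (nat \<Rightarrow> nat \<Rightarrow> bool) \<times> (nat \<Rightarrow> bool option)) pmf" where
  "scheme_experiment P N m T strat =
     do { pv \<leftarrow> Pi_pmf {..<m} (1/2) (\<lambda>_. P);
          w \<leftarrow> Pi_pmf {..<N} (\<lambda>_. False)
                 (\<lambda>_. Pi_pmf {..<m} False (\<lambda>j. bernoulli_pmf (pv j)));
          y \<leftarrow> strat (pirate_view T m w);
          return_pmf (pv, w, y) }"

definition false_positive ::
  "(nat \<Rightarrow> real) \<Rightarrow> nat \<Rightarrow> (nat \<Rightarrow> real) \<Rightarrow> nat \<Rightarrow> nat \<Rightarrow> nat set \<Rightarrow> real
   \<Rightarrow> ((nat \<Rightarrow> real) \<times> (nat \<Rightarrow> nat \<Rightarrow> bool) \<times> (nat \<Rightarrow> bool option)) set" where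
  "false_positive p k U N m T Z =
     {(pv, w, y). \<exists>i<N. i \<notin> T \<and> approx_score p k U m pv w y i \<ge> Z}"

definition false_negative ::
  "(nat \<Rightarrow> real) \<Rightarrow> nat \<Rightarrow> (nat \<Rightarrow> real) \<Rightarrow> nat \<Rightarrow> nat set \<Rightarrow> real
   \<Rightarrow> ((nat \<Rightarrow> real) \<times> (nat \<Rightarrow> nat \<Rightarrow> bool) \<times> (nat \<Rightarrow> bool option)) set" where
  "false_negative p k U m T Z =
     {(pv, w, y). \<forall>i\<in>T. approx_score p k U m pv w y i < Z}"

end

theory Submission
  imports Defs
begin

text \<open>
  Both error probabilities are bounded by Chernoff arguments based on
  \<open>exp t \<le> 1 + t + t\<^sup>2 * r x\<close> for \<open>t \<le> x\<close>. Replacing \<open>U\<close> by the exact scores costs at most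
  \<open>m * \<delta>\<close> per user. An innocent user's exact score is, given the biases and the pirated word, a sum of
  independent terms with mean 0 and variance at most 1.

  For the pirates consider the sum of their scores. Given their codewords, the pirated
  word is independent of the biases, so after exchanging the order of integration the expectation of
  \<open>exp (- b * S)\<close> factorizes over the positions. In each factor the pirates' choice can be replaced by
  the best symbol allowed for that column by the Marking Assumption. Since the coalition score has mean 0, the
  first-order term of the sum over all columns is exactly \<open>- b * R_lP\<close>; its
  second moment is \<open>l\<close>.
\<close>

section \<open>Quadratic bounds for the exponential function\<close>

text \<open>With \<open>s = - t\<close>, the identity
  \<open>(1 - s + s^2/2) * (1 + s + s^2/2) = 1 + s^4/4\<close> bounds the product below by 1, and
  its second factor is at most \<open>exp s\<close>.\<close>

lemma exp_nonpos_le_quadratic: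
  fixes t :: real
  assumes "t \<le> 0"
  shows "exp t \<le> 1 + t + t\<^sup>2 / 2"
proof -
  define s where "s = - t"
  have s: "s \<ge> 0" using assms by (simp add: s_def)
  have lower: "1 + s + s\<^sup>2 / 2 \<le> exp s"
    using exp_lower_Taylor_quadratic[OF s] by simp
  have pos: "1 - s + s\<^sup>2 / 2 \<ge> 0"
    using zero_le_power2[of "s - 1"] by (simp add: power2_eq_square algebra_simps)
  have "1 \<le> 1 + s^4 / 4" by simp
  also have "\<dots> = (1 - s + s\<^sup>2 / 2) * (1 + s + s\<^sup>2 / 2)"
    by (simp add: algebra_simps power2_eq_square power4_eq_xxxx)
  also have "\<dots> \<le> (1 - s + s\<^sup>2 / 2) * exp s"
    using lower pos by (rule mult_left_mono)
  finally have "exp (- s) \<le> 1 - s + s\<^sup>2 / 2"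
    by (simp add: exp_minus field_simps)
  then show ?thesis by (simp add: s_def)
qed

lemma exp_minus_linear_sums:
  "(\<lambda>n. (t::real) ^ (n + 2) / fact (n + 2)) sums (exp t - 1 - t)"
proof -
  have "(\<lambda>n. t ^ n / fact n) sums exp t"
    using exp_converges[of t] by (simp add: divide_inverse mult.commute)
  then have "(\<lambda>n. t ^ (n + 2) / fact (n + 2)) sums (exp t - (\<Sum>i<2. t ^ i / fact i))"
    by (rule sums_split_initial_segment)
  then show ?thesis by (simp add: numeral_2_eq_2 algebra_simps)
qed

lemma r_fun_ge_half:
  assumes "x > 0"
  shows "1 / 2 \<le> r_fun x"
  using exp_lower_Taylor_quadratic[of x] assms
  by (simp add: r_fun_def field_simps)

text \<open>For \<open>t > 0\<close>, \<open>r_fun\<close> has a power series with nonnegative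
  coefficients, so \<open>r_fun t \<le> r_fun x\<close>, proved by comparing the series term by
  term. For \<open>t \<le> 0\<close> the coefficient 1/2 suffices. The condition on \<open>t\<close>
  is one-sided, so very negative exponents are allowed; the Chernoff arguments rely on this.\<close>

lemma exp_le_quadratic_r_fun:
  assumes "x > 0" "t \<le> x"
  shows "exp t \<le> 1 + t + t\<^sup>2 * r_fun x"
proof (cases "t \<le> 0")
  case True
  have "exp t \<le> 1 + t + t\<^sup>2 * (1 / 2)"
    using exp_nonpos_le_quadratic[OF True] by simp
  also have "\<dots> \<le> 1 + t + t\<^sup>2 * r_fun x"
    using r_fun_ge_half[OF assms(1)] by (intro add_left_mono mult_left_mono) auto
  finally show ?thesis .
next
  case False
  have le: "t ^ (n + 2) / fact (n + 2) \<le> (t\<^sup>2 / x\<^sup>2) * (x ^ (n + 2) / fact (n + 2))" for n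
  proof -
    have "t ^ n \<le> x ^ n" using False assms by (intro power_mono) auto
    then have "t\<^sup>2 * t ^ n \<le> t\<^sup>2 * x ^ n" by (intro mult_left_mono) auto
    then have "t\<^sup>2 * t ^ n / fact (n + 2) \<le> t\<^sup>2 * x ^ n / fact (n + 2)"
      by (intro divide_right_mono) auto
    then show ?thesis using assms by (simp add: power_add power2_eq_square field_simps)
  qed
  have "exp t - 1 - t \<le> (t\<^sup>2 / x\<^sup>2) * (exp x - 1 - x)"
    by (rule sums_le[OF le exp_minus_linear_sums sums_mult[OF exp_minus_linear_sums]])
  then show ?thesis by (simp add: r_fun_def)
qed

section \<open>Exact scores, their moments and the symmetry of the support\<close>

lemma sigma_fp_pos:
  assumes "0 < q" "q < 1"
  shows "sigma_fp q > 0"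
  using assms by (simp add: sigma_fp_def)

lemma sigma_fp_antimono:
  assumes "0 < q" "q \<le> q'" "q' < 1"
  shows "sigma_fp q' \<le> sigma_fp q"
  using assms unfolding sigma_fp_def by (intro real_sqrt_le_mono frac_le) auto

text \<open>Puts \<open>sigma_fp q\<close> and \<open>sigma_fp (1 - q)\<close> over a common
  denominator, the standard deviation of a Bernoulli bit with bias \<open>q\<close>.\<close>

lemma sigma_fp_eq:
  assumes "0 < q" "q < 1"
  shows "sigma_fp q = (1 - q) / sqrt (q * (1 - q))"
proof -
  have "sigma_fp q = sqrt ((1 - q)\<^sup>2 / (q * (1 - q)))"
    using assms by (simp add: sigma_fp_def power2_eq_square)
  also have "\<dots> = (1 - q) / sqrt (q * (1 - q))"
    using assms by (simp add: real_sqrt_divide)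
  finally show ?thesis .
qed

text \<open>The sum of the exact scores of \<open>l\<close> pirates at a position with bias
  \<open>q\<close> and output 1, when \<open>x\<close> of them hold a 1. It is the second factor of
  \<open>f_fp\<close>.\<close>

definition coalition_score :: "nat \<Rightarrow> nat \<Rightarrow> real \<Rightarrow> real" where
  "coalition_score l x q = real x * sigma_fp q - real (l - x) * sigma_fp (1 - q)"

lemma f_fp_coalition_score:
  "f_fp l x q = q ^ x * (1 - q) ^ (l - x) * coalition_score l x q"
  by (simp add: f_fp_def coalition_score_def)

text \<open>In this form the score is a centred binomial count divided by the standard deviation of
  one bit. Under the Bernstein weights it therefore has mean 0 and variance
  \<open>l\<close>.\<close>

lemma coalition_score_eq:
  assumes "0 < q" "q < 1" "x \<le> l"
  shows "coalition_score l x q = (real x - real l * q) / sqrt (q * (1 - q))"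
proof -
  have "coalition_score l x q
      = (real x * (1 - q) - (real l - real x) * q) / sqrt (q * (1 - q))"
    using assms
    by (simp add: coalition_score_def sigma_fp_eq[of q] sigma_fp_eq[of "1 - q"]
        diff_divide_distrib[symmetric] mult.commute[of _ q] of_nat_diff)
  then show ?thesis by (simp add: algebra_simps)
qed

lemma sum_Bernstein_coalition_score:
  assumes "0 < q" "q < 1"
  shows "(\<Sum>x\<le>l. Bernstein l x q * coalition_score l x q) = 0"
proof -
  have "(\<Sum>x\<le>l. Bernstein l x q * coalition_score l x q)
      = (\<Sum>x\<le>l. (real x * Bernstein l x q - real l * q * Bernstein l x q) / sqrt (q * (1 - q)))"
    using assms by (intro sum.cong) (auto simp: coalition_score_eq algebra_simps)
  also have "\<dots> = 0"
    by (simp add: sum_divide_distrib[symmetric] sum_subtractf sum_distrib_left[symmetric])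
  finally show ?thesis .
qed

text \<open>The square of \<open>x - l * q\<close> is expanded in \<open>x * (x - 1)\<close>,
  \<open>x\<close> and 1, whose Bernstein sums are known.\<close>

lemma sum_Bernstein_coalition_score_square:
  assumes "0 < q" "q < 1"
  shows "(\<Sum>x\<le>l. Bernstein l x q * (coalition_score l x q)\<^sup>2) = real l"
proof -
  have "(\<Sum>x\<le>l. Bernstein l x q * (coalition_score l x q)\<^sup>2)
      = (\<Sum>x\<le>l. (real x * (real x - 1) * Bernstein l x q
            + (1 - 2 * real l * q) * (real x * Bernstein l x q)
            + (real l * q)\<^sup>2 * Bernstein l x q) / (q * (1 - q)))"
    using assms
    by (intro sum.cong)
       (auto simp: coalition_score_eq power_divide power2_eq_square algebra_simps)
  also have "\<dots> = (real l * (real l - 1) * q\<^sup>2 + (1 - 2 * real l * q) * (real l * q)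
      + (real l * q)\<^sup>2) / (q * (1 - q))"
    by (simp add: sum_divide_distrib[symmetric] sum.distrib sum_distrib_left[symmetric])
  also have "\<dots> = real l"
    using assms by (simp add: field_simps power2_eq_square)
  finally show ?thesis .
qed

text \<open>The rank of \<open>1 - p i\<close> in the support is the number of points above \<open>p i\<close>, that is \<open>k - i\<close>.\<close>
lemma symmetric_enumeration_reflect:
  fixes p :: "nat \<Rightarrow> real"
  assumes mono: "strict_mono_on {..k} p" and S: "S = p ` {..k}"
    and sym: "\<And>q. q \<in> S \<Longrightarrow> 1 - q \<in> S" and i: "i \<le> k"
  shows "p (k - i) = 1 - p i"
proof -
  have less: "p a < p b \<longleftrightarrow> a < b" if "a \<le> k" "b \<le> k" for a b
    using strict_mono_on_less[OF mono] that by simp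
  have inj: "inj_on p {..k}" using mono by (rule strict_mono_on_imp_inj_on)
  have below: "card {q \<in> S. q < p a} = a" if "a \<le> k" for a
  proof -
    have "{q \<in> S. q < p a} = p ` {..<a}"
      using that by (force simp: S less)
    then show ?thesis
      using that by (auto intro!: card_image[THEN trans] inj_on_subset[OF inj])
  qed
  have above: "card {q \<in> S. p i < q} = k - i"
  proof -
    have "{q \<in> S. p i < q} = p ` {i<..k}"
      using i by (force simp: S less)
    then show ?thesis
      by (auto intro!: card_image[THEN trans] inj_on_subset[OF inj])
  qed
  obtain i' where i': "i' \<le> k" "1 - p i = p i'"
    using sym[of "p i"] i unfolding S by auto
  have "{q \<in> S. q < p i'} = (\<lambda>q. 1 - q) ` {q \<in> S. p i < q}"
  proof safe
    fix q assume "q \<in> S" "q < p i'"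
    then show "q \<in> (\<lambda>q. 1 - q) ` {q \<in> S. p i < q}"
      using i' sym by (intro image_eqI[of _ _ "1 - q"]) auto
  qed (use i' sym in auto)
  then have "card {q \<in> S. q < p i'} = card {q \<in> S. p i < q}"
    by (simp add: card_image inj_on_def)
  then have "i' = k - i" using below[OF i'(1)] above by simp
  then show ?thesis using i' by simp
qed

section \<open>Integrals over pmfs and products of pmfs\<close>

lemma prob_bind_pmf_le:
  assumes "\<And>x. x \<in> set_pmf M \<Longrightarrow> measure_pmf.prob (f x) A \<le> B" and "0 \<le> B"
  shows "measure_pmf.prob (bind_pmf M f) A \<le> B"
proof -
  have "emeasure (bind_pmf M f) A = (\<integral>\<^sup>+x. emeasure (f x) A \<partial>M)" by simp
  also have "\<dots> \<le> (\<integral>\<^sup>+x. ennreal B \<partial>M)"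
    using assms
    by (intro nn_integral_mono_AE)
       (auto simp: AE_measure_pmf_iff measure_pmf.emeasure_eq_measure intro!: ennreal_leI)
  finally show ?thesis
    using assms(2) by (simp add: measure_pmf.emeasure_eq_measure)
qed

text \<open>Markov's inequality in the shape needed for Chernoff bounds, with \<open>f\<close> an
  exponential that is at least 1 on the event.\<close>

lemma prob_le_nn_integral_pmf:
  assumes "\<And>x. x \<in> set_pmf M \<Longrightarrow> x \<in> A \<Longrightarrow> 1 \<le> f x"
  shows "ennreal (measure_pmf.prob M A) \<le> (\<integral>\<^sup>+x. f x \<partial>M)"
proof -
  have "ennreal (measure_pmf.prob M A) = (\<integral>\<^sup>+x. indicator A x \<partial>M)"
    by (simp add: measure_pmf.emeasure_eq_measure)
  also have "\<dots> \<le> (\<integral>\<^sup>+x. f x \<partial>M)"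
    using assms by (intro nn_integral_mono_AE) (auto simp: AE_measure_pmf_iff indicator_def)
  finally show ?thesis .
qed

text \<open>Both sides are integrals over a pmf of pairs, with the components drawn in the two
  possible orders; \<open>bind_commute_pmf\<close> identifies these pmfs.\<close>

lemma nn_integral_pmf_swap:
  "(\<integral>\<^sup>+x. \<integral>\<^sup>+y. f x y \<partial>measure_pmf B \<partial>measure_pmf A)
     = (\<integral>\<^sup>+y. \<integral>\<^sup>+x. f x y \<partial>measure_pmf A \<partial>measure_pmf B)"
proof -
  have "(\<integral>\<^sup>+z. f (fst z) (snd z) \<partial>bind_pmf A (\<lambda>x. bind_pmf B (\<lambda>y. return_pmf (x, y))))
      = (\<integral>\<^sup>+z. f (fst z) (snd z) \<partial>bind_pmf B (\<lambda>y. bind_pmf A (\<lambda>x. return_pmf (x, y))))"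
    by (subst bind_commute_pmf) (rule refl)
  then show ?thesis by simp
qed

text \<open>The double product is symmetric in the two index sets, which makes transposition a
  matter of \<open>prod.swap\<close>.\<close>

lemma pmf_Pi_Pi:
  assumes "finite A" "finite B"
  shows "pmf (Pi_pmf A (\<lambda>_. d) (\<lambda>i. Pi_pmf B d (q i))) f
    = (if \<forall>i j. i \<in> A \<and> j \<in> B \<or> f i j = d then \<Prod>i\<in>A. \<Prod>j\<in>B. pmf (q i j) (f i j) else 0)"
proof (cases "\<forall>i j. i \<in> A \<and> j \<in> B \<or> f i j = d")
  case True
  then have "\<forall>i. i \<notin> A \<longrightarrow> f i = (\<lambda>_. d)" "\<forall>i j. j \<notin> B \<longrightarrow> f i j = d" by auto
  then show ?thesis using assms True by (simp add: pmf_Pi)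
next
  case False
  then obtain i j where ij: "\<not> (i \<in> A \<and> j \<in> B)" "f i j \<noteq> d" by auto
  have "pmf (Pi_pmf A (\<lambda>_. d) (\<lambda>i. Pi_pmf B d (q i))) f = 0"
  proof (cases "i \<in> A")
    case True
    then have "pmf (Pi_pmf B d (q i)) (f i) = 0"
      using ij assms by (intro pmf_Pi_outside) auto
    then have "(\<Prod>i\<in>A. pmf (Pi_pmf B d (q i)) (f i)) = 0"
      using True assms by (intro prod_zero) auto
    then show ?thesis using assms by (subst pmf_Pi) auto
  next
    case False
    then show ?thesis using ij assms by (intro pmf_Pi_outside) (auto simp: fun_eq_iff)
  qed
  then show ?thesis by (simp only: if_not_P[OF False])
qed

text \<open>Codewords are drawn user by user, whereas the factorization over positions needs the
  matrix column by column. As all entries are independent, both orders have the same mass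
  function.\<close>

lemma Pi_pmf_transpose:
  assumes "finite A" "finite B"
  shows "Pi_pmf A (\<lambda>_. d) (\<lambda>i. Pi_pmf B d (q i))
    = map_pmf (\<lambda>g i j. g j i) (Pi_pmf B (\<lambda>_. d) (\<lambda>j. Pi_pmf A d (\<lambda>i. q i j)))"
proof (rule pmf_eqI)
  fix f :: "'a \<Rightarrow> 'b \<Rightarrow> 'c"
  let ?t = "\<lambda>(g :: 'b \<Rightarrow> 'a \<Rightarrow> 'c) i j. g j i"
  have inj: "inj ?t" by (auto simp: inj_def fun_eq_iff)
  have "pmf (map_pmf ?t (Pi_pmf B (\<lambda>_. d) (\<lambda>j. Pi_pmf A d (\<lambda>i. q i j)))) f
      = pmf (Pi_pmf B (\<lambda>_. d) (\<lambda>j. Pi_pmf A d (\<lambda>i. q i j))) (\<lambda>j i. f i j)"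
    using pmf_map_inj'[OF inj, of _ "\<lambda>j i. f i j"] by simp
  also have "\<dots> = pmf (Pi_pmf A (\<lambda>_. d) (\<lambda>i. Pi_pmf B d (q i))) f"
    unfolding pmf_Pi_Pi[OF assms] pmf_Pi_Pi[OF assms(2,1)]
    by (subst prod.swap) (auto intro: if_cong)
  finally show "pmf (Pi_pmf A (\<lambda>_. d) (\<lambda>i. Pi_pmf B d (q i))) f
    = pmf (map_pmf ?t (Pi_pmf B (\<lambda>_. d) (\<lambda>j. Pi_pmf A d (\<lambda>i. q i j)))) f" ..
qed

lemma sum_PiE_dflt_prod:
  fixes M :: "'c \<Rightarrow> 'b::comm_semiring_1"
  assumes "finite J" "finite V"
  shows "(\<Sum>v\<in>PiE_dflt J d (\<lambda>_. V). \<Prod>j\<in>J. M (v j)) = (\<Sum>v\<in>V. M v) ^ card J"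
proof -
  have "(\<Sum>v\<in>PiE_dflt J d (\<lambda>_. V). \<Prod>j\<in>J. M (v j)) = (\<Sum>v\<in>PiE J (\<lambda>_. V). \<Prod>j\<in>J. M (v j))"
    \<comment> \<open>The two function spaces differ only in the value outside \<open>J\<close>,
      which is \<open>d\<close> in one and \<open>undefined\<close> in the other.\<close>
    by (rule sum.reindex_bij_witness
        [of _ "\<lambda>v j. if j \<in> J then v j else d" "\<lambda>v. restrict v J"])
       (auto simp: PiE_dflt_def PiE_def extensional_def fun_eq_iff intro!: prod.cong)
  also have "\<dots> = (\<Prod>j\<in>J. \<Sum>v\<in>V. M v)"
    using assms by (subst prod_sum_PiE) auto
  finally show ?thesis by simp
qed

section \<open>Factorization over positions against an adversary\<close>

text \<open>Here \<open>q\<close> is a hidden bias, \<open>v\<close> a column drawn from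
  \<open>Q q\<close>, and \<open>s\<close> a symbol that \<open>adm\<close> allows for the column.
  The strategy \<open>S\<close> sees all columns but no bias. For a fixed matrix the biases can thus
  be integrated first, and the integral factorizes although each symbol may depend on every column.
  Each factor is at most \<open>M\<close> of its column, and the sum over all matrices is a
  power.\<close>

lemma adversarial_product_bound:
  fixes P :: "'a pmf" and Q :: "'a \<Rightarrow> 'c pmf" and h :: "'a \<Rightarrow> 'c \<Rightarrow> 's \<Rightarrow> ennreal"
    and S :: "('j \<Rightarrow> 'c) \<Rightarrow> ('j \<Rightarrow> 's) pmf"
  assumes fin: "finite J" "finite V"
    and Q: "\<And>q. set_pmf (Q q) \<subseteq> V"
    and bound: "\<And>v s. v \<in> V \<Longrightarrow> adm v s \<Longrightarrow> (\<integral>\<^sup>+q. ennreal (pmf (Q q) v) * h q v s \<partial>P) \<le> M v"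
    and S: "\<And>v y j. y \<in> set_pmf (S v) \<Longrightarrow> j \<in> J \<Longrightarrow> adm (v j) (y j)"
  shows "(\<integral>\<^sup>+pv. \<integral>\<^sup>+v. \<integral>\<^sup>+y. (\<Prod>j\<in>J. h (pv j) (v j) (y j))
      \<partial>S v \<partial>Pi_pmf J d' (\<lambda>j. Q (pv j)) \<partial>Pi_pmf J d (\<lambda>_. P)) \<le> (\<Sum>v\<in>V. M v) ^ card J"
proof -
  let ?W = "PiE_dflt J d' (\<lambda>_. V)"
  let ?P = "Pi_pmf J d (\<lambda>_. P)"
  have finW: "finite ?W" using fin by auto
  \<comment> \<open>The column probabilities become weights inside the product, so the outer sum no
    longer depends on the biases.\<close>
  have expand: "(\<integral>\<^sup>+v. \<integral>\<^sup>+y. (\<Prod>j\<in>J. h (pv j) (v j) (y j)) \<partial>S v \<partial>Pi_pmf J d' (\<lambda>j. Q (pv j)))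
      = (\<Sum>v\<in>?W. \<integral>\<^sup>+y. (\<Prod>j\<in>J. ennreal (pmf (Q (pv j)) (v j)) * h (pv j) (v j) (y j)) \<partial>S v)" for pv
  proof -
    have "set_pmf (Pi_pmf J d' (\<lambda>j. Q (pv j))) \<subseteq> ?W"
      using Q fin by (auto simp: set_Pi_pmf PiE_dflt_def)
    then have "(\<integral>\<^sup>+v. \<integral>\<^sup>+y. (\<Prod>j\<in>J. h (pv j) (v j) (y j)) \<partial>S v \<partial>Pi_pmf J d' (\<lambda>j. Q (pv j)))
      = (\<Sum>v\<in>?W. (\<integral>\<^sup>+y. (\<Prod>j\<in>J. h (pv j) (v j) (y j)) \<partial>S v)
            * ennreal (pmf (Pi_pmf J d' (\<lambda>j. Q (pv j))) v))"
      using finW by (intro nn_integral_measure_pmf_support) auto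
    also have "\<dots> = (\<Sum>v\<in>?W. \<integral>\<^sup>+y. (\<Prod>j\<in>J. ennreal (pmf (Q (pv j)) (v j)) * h (pv j) (v j) (y j)) \<partial>S v)"
    proof (rule sum.cong[OF refl])
      fix v assume "v \<in> ?W"
      then have "pmf (Pi_pmf J d' (\<lambda>j. Q (pv j))) v = (\<Prod>j\<in>J. pmf (Q (pv j)) (v j))"
        using fin by (intro pmf_Pi') (auto simp: PiE_dflt_def)
      then show "(\<integral>\<^sup>+y. (\<Prod>j\<in>J. h (pv j) (v j) (y j)) \<partial>S v)
            * ennreal (pmf (Pi_pmf J d' (\<lambda>j. Q (pv j))) v)
          = (\<integral>\<^sup>+y. (\<Prod>j\<in>J. ennreal (pmf (Q (pv j)) (v j)) * h (pv j) (v j) (y j)) \<partial>S v)"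
        by (simp add: prod.distrib nn_integral_cmult prod_ennreal mult.commute)
    qed
    finally show ?thesis .
  qed
  have "(\<integral>\<^sup>+pv. \<integral>\<^sup>+v. \<integral>\<^sup>+y. (\<Prod>j\<in>J. h (pv j) (v j) (y j))
      \<partial>S v \<partial>Pi_pmf J d' (\<lambda>j. Q (pv j)) \<partial>?P)
    = (\<Sum>v\<in>?W. \<integral>\<^sup>+pv. \<integral>\<^sup>+y. (\<Prod>j\<in>J. ennreal (pmf (Q (pv j)) (v j)) * h (pv j) (v j) (y j)) \<partial>S v \<partial>?P)"
    unfolding expand by (simp add: nn_integral_sum)
  also have "\<dots> \<le> (\<Sum>v\<in>?W. \<Prod>j\<in>J. M (v j))"
  proof (rule sum_mono)
    \<comment> \<open>The law \<open>S v\<close> does not involve \<open>pv\<close>, so the two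
      integrals may be exchanged; the product law of the biases then splits the inner one.\<close>
    fix v assume v: "v \<in> ?W"
    have "(\<integral>\<^sup>+pv. \<integral>\<^sup>+y. (\<Prod>j\<in>J. ennreal (pmf (Q (pv j)) (v j)) * h (pv j) (v j) (y j)) \<partial>S v \<partial>?P)
      = (\<integral>\<^sup>+y. \<integral>\<^sup>+pv. (\<Prod>j\<in>J. ennreal (pmf (Q (pv j)) (v j)) * h (pv j) (v j) (y j)) \<partial>?P \<partial>S v)"
      by (rule nn_integral_pmf_swap)
    also have "\<dots> = (\<integral>\<^sup>+y. (\<Prod>j\<in>J. \<integral>\<^sup>+q. ennreal (pmf (Q q) (v j)) * h q (v j) (y j) \<partial>P) \<partial>S v)"
      using fin by (subst nn_integral_prod_Pi_pmf[where f = "\<lambda>j q. ennreal (pmf (Q q) (v j)) * h q (v j) (_ j)"]) auto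
    also have "\<dots> \<le> (\<integral>\<^sup>+y. (\<Prod>j\<in>J. M (v j)) \<partial>S v)"
      using v S[of _ v] bound
      by (intro nn_integral_mono_AE) (auto simp: AE_measure_pmf_iff PiE_dflt_def intro!: prod_mono_ennreal)
    also have "\<dots> = (\<Prod>j\<in>J. M (v j))" by simp
    finally show "(\<integral>\<^sup>+pv. \<integral>\<^sup>+y. (\<Prod>j\<in>J. ennreal (pmf (Q (pv j)) (v j)) * h (pv j) (v j) (y j)) \<partial>S v \<partial>?P)
      \<le> (\<Prod>j\<in>J. M (v j))" .
  qed
  also have "\<dots> = (\<Sum>v\<in>V. M v) ^ card J" using fin by (rule sum_PiE_dflt_prod)
  finally show ?thesis .
qed

text \<open>Columns correspond to the subsets of \<open>T\<close> holding a 1, and these are grouped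
  by size.\<close>

lemma sum_PiE_dflt_bool_card:
  fixes F :: "nat \<Rightarrow> 'b::comm_semiring_1"
  assumes "finite T"
  shows "(\<Sum>v\<in>PiE_dflt T False (\<lambda>_. UNIV). F (card {i \<in> T. v i}))
    = (\<Sum>x\<le>card T. of_nat (card T choose x) * F x)"
proof -
  have "(\<Sum>v\<in>PiE_dflt T False (\<lambda>_. UNIV). F (card {i \<in> T. v i})) = (\<Sum>X\<in>Pow T. F (card X))"
    by (rule sum.reindex_bij_witness[of _ "\<lambda>X i. i \<in> X" "\<lambda>v. {i \<in> T. v i}"])
       (auto simp: PiE_dflt_def fun_eq_iff)
  also have "\<dots> = (\<Sum>x\<le>card T. \<Sum>X\<in>{X \<in> Pow T. card X = x}. F (card X))"
    using assms by (intro sum.group[symmetric]) (auto intro: card_mono)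
  also have "\<dots> = (\<Sum>x\<le>card T. of_nat (card T choose x) * F x)"
    using n_subsets[OF assms] by (intro sum.cong) auto
  finally show ?thesis .
qed

lemma pmf_Pi_bernoulli:
  assumes "finite T" "0 \<le> q" "q \<le> 1" "v \<in> PiE_dflt T False (\<lambda>_. UNIV)"
  shows "pmf (Pi_pmf T False (\<lambda>_. bernoulli_pmf q)) v
    = q ^ card {i \<in> T. v i} * (1 - q) ^ (card T - card {i \<in> T. v i})"
proof -
  have "pmf (Pi_pmf T False (\<lambda>_. bernoulli_pmf q)) v = (\<Prod>i\<in>T. pmf (bernoulli_pmf q) (v i))"
    using assms by (intro pmf_Pi') (auto simp: PiE_dflt_def)
  also have "\<dots> = (\<Prod>i\<in>T. if v i then q else 1 - q)"
    using assms by (intro prod.cong) auto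
  also have "\<dots> = q ^ card {i \<in> T. v i} * (1 - q) ^ card {i \<in> T. \<not> v i}"
    using assms by (simp add: prod.If_cases Int_def)
  also have "{i \<in> T. \<not> v i} = T - {i \<in> T. v i}" by auto
  also have "card \<dots> = card T - card {i \<in> T. v i}"
    using assms by (intro card_Diff_subset) auto
  finally show ?thesis .
qed

section \<open>Tail bound for one innocent user\<close>

text \<open>The summand that \<open>approx_score\<close> approximates: the value \<open>U\<close> at
  the reflected index is replaced by \<open>sigma_fp (1 - q)\<close>.\<close>

definition user_score :: "real \<Rightarrow> bool \<Rightarrow> bool option \<Rightarrow> real" where
  "user_score q b s = (if s = Some True then (if b then sigma_fp q else - sigma_fp (1 - q)) else 0)"

text \<open>When the output is 1, the score of an independent bit has mean 0 and variance 1, so only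
  the constant and the quadratic term survive. Otherwise the score is 0.\<close>

lemma bernoulli_user_score_mgf:
  assumes q: "0 < q" "q < 1" and x: "0 < x" and a: "0 < a" "a * sigma_fp q \<le> x"
  shows "exp (a * user_score q True s) * q + exp (a * user_score q False s) * (1 - q)
    \<le> 1 + a\<^sup>2 * r_fun x"
proof (cases "s = Some True")
  case True
  define \<rho> where "\<rho> = r_fun x"
  define d where "d = sqrt (q * (1 - q))"
  have d: "d > 0" "d\<^sup>2 = q * (1 - q)" using q by (simp_all add: d_def)
  have \<sigma>: "sigma_fp q = (1 - q) / d" "sigma_fp (1 - q) = q / d"
    using sigma_fp_eq[of q] sigma_fp_eq[of "1 - q"] q by (simp_all add: d_def mult.commute)
  have up: "exp (a * ((1 - q) / d)) \<le> 1 + a * ((1 - q) / d) + (a * ((1 - q) / d))\<^sup>2 * \<rho>"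
    unfolding \<rho>_def using x a by (intro exp_le_quadratic_r_fun) (auto simp: \<sigma>)
  have "a * - (q / d) \<le> 0" using a q d by simp
  then have "a * - (q / d) \<le> x" using x by linarith
  then have down: "exp (a * - (q / d)) \<le> 1 + a * - (q / d) + (a * - (q / d))\<^sup>2 * \<rho>"
    unfolding \<rho>_def using x by (intro exp_le_quadratic_r_fun) auto
  have "exp (a * user_score q True s) * q + exp (a * user_score q False s) * (1 - q)
      \<le> (1 + a * ((1 - q) / d) + (a * ((1 - q) / d))\<^sup>2 * \<rho>) * q
        + (1 + a * - (q / d) + (a * - (q / d))\<^sup>2 * \<rho>) * (1 - q)"
    using True up down q by (auto simp: user_score_def \<sigma> intro!: add_mono mult_right_mono)
  also have "\<dots> = 1 + a\<^sup>2 * \<rho> * ((q * (1 - q)) / d\<^sup>2)"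
    using d(1) by (simp add: field_simps power2_eq_square)
  also have "\<dots> = 1 + a\<^sup>2 * \<rho>" using d q by simp
  finally show ?thesis by (simp add: \<rho>_def)
next
  case False
  then show ?thesis using r_fun_ge_half[OF x] by (simp add: user_score_def)
qed

text \<open>Chernoff bound with exponent \<open>a\<close>. The biases and the pirated word are
  fixed, so the bits of the codeword \<open>h\<close> are independent and the moment generating
  function factorizes.\<close>

lemma innocent_score_tail:
  fixes pv :: "nat \<Rightarrow> real" and y :: "nat \<Rightarrow> bool option"
  assumes pv: "\<And>j. j < m \<Longrightarrow> 0 < pv j \<and> pv j < 1 \<and> a * sigma_fp (pv j) \<le> x"
    and x: "0 < x" and a: "0 < a"
  shows "measure_pmf.prob (Pi_pmf {..<m} False (\<lambda>j. bernoulli_pmf (pv j)))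
      {h. z \<le> (\<Sum>j<m. user_score (pv j) (h j) (y j))}
    \<le> exp (- a * z) * (1 + a\<^sup>2 * r_fun x) ^ m"
proof -
  let ?M = "Pi_pmf {..<m} False (\<lambda>j. bernoulli_pmf (pv j))"
  let ?e = "\<lambda>j b. ennreal (exp (a * user_score (pv j) b (y j)))"
  have nonneg: "0 \<le> 1 + a\<^sup>2 * r_fun x"
    using r_fun_ge_half[OF x] by simp
  have "ennreal (measure_pmf.prob ?M {h. z \<le> (\<Sum>j<m. user_score (pv j) (h j) (y j))})
      \<le> (\<integral>\<^sup>+h. ennreal (exp (- a * z)) * (\<Prod>j<m. ?e j (h j)) \<partial>?M)"
  proof (rule prob_le_nn_integral_pmf)
    fix h assume "h \<in> {h. z \<le> (\<Sum>j<m. user_score (pv j) (h j) (y j))}"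
    then have "1 \<le> exp (- a * z + a * (\<Sum>j<m. user_score (pv j) (h j) (y j)))"
      using a by simp
    also have "\<dots> = exp (- a * z) * (\<Prod>j<m. exp (a * user_score (pv j) (h j) (y j)))"
      by (simp add: exp_add[symmetric] exp_sum[symmetric] sum_distrib_left)
    finally show "1 \<le> ennreal (exp (- a * z)) * (\<Prod>j<m. ?e j (h j))"
      by (simp add: prod_ennreal ennreal_mult[symmetric] prod_nonneg)
  qed
  also have "\<dots> = ennreal (exp (- a * z)) * (\<Prod>j<m. \<integral>\<^sup>+b. ?e j b \<partial>bernoulli_pmf (pv j))"
    by (subst nn_integral_cmult) (simp_all add: nn_integral_prod_Pi_pmf[where f = ?e])
  also have "\<dots> \<le> ennreal (exp (- a * z)) * (\<Prod>j<m. ennreal (1 + a\<^sup>2 * r_fun x))"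
  proof (intro mult_left_mono prod_mono_ennreal)
    fix j assume "j \<in> {..<m}"
    then have q: "0 < pv j" "pv j < 1" "a * sigma_fp (pv j) \<le> x" using pv by auto
    show "(\<integral>\<^sup>+b. ?e j b \<partial>bernoulli_pmf (pv j)) \<le> ennreal (1 + a\<^sup>2 * r_fun x)"
      using bernoulli_user_score_mgf[OF q(1,2) x a q(3), of "y j"] q
      by (simp add: ennreal_mult[symmetric] ennreal_plus[symmetric] ennreal_leI
          del: ennreal_plus)
  qed simp
  also have "\<dots> = ennreal (exp (- a * z) * (1 + a\<^sup>2 * r_fun x) ^ m)"
    using nonneg by (simp add: ennreal_power ennreal_mult[symmetric])
  finally show ?thesis using nonneg by simp
qed

section \<open>The pirates' best response in one column\<close>

lemma sum_user_score_coalition: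
  assumes "finite T"
  shows "(\<Sum>i\<in>T. user_score q (v i) s)
    = (if s = Some True then coalition_score (card T) (card {i \<in> T. v i}) q else 0)"
proof -
  have "{i \<in> T. \<not> v i} = T - {i \<in> T. v i}" by auto
  then have "card {i \<in> T. \<not> v i} = card T - card {i \<in> T. v i}"
    using assms by (simp add: card_Diff_subset)
  then show ?thesis
    using assms by (simp add: user_score_def coalition_score_def sum.If_cases Int_def)
qed

text \<open>Bounds the pirates' best response to a column with \<open>x\<close> ones. The last summand is the
  first-order term: it is \<open>- E f\<close> at \<open>x = l\<close> (output 1 is forced), \<open>0\<close> at \<open>x = 0\<close> (output 0 is forced) and
  \<open>max 0 (- E f)\<close> in between.\<close>
definition column_bound :: "real pmf \<Rightarrow> real \<Rightarrow> real \<Rightarrow> nat \<Rightarrow> nat \<Rightarrow> real" where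
  "column_bound P b \<rho> l x =
     measure_pmf.expectation P (\<lambda>q. q ^ x * (1 - q) ^ (l - x))
     + b\<^sup>2 * \<rho> * measure_pmf.expectation P (\<lambda>q. q ^ x * (1 - q) ^ (l - x) * (coalition_score l x q)\<^sup>2)
     + b * ((if x \<in> {1..l - 1} then R_lx P l x else 0)
            - measure_pmf.expectation P (f_fp l x)
            + (if x = 0 then measure_pmf.expectation P (f_fp l 0) else 0))"

text \<open>Weighted by binomial coefficients, the zeroth-order terms sum to 1 and the second
  moments to \<open>l\<close>. The terms \<open>- E f\<close> cancel because the coalition score has
  mean 0, and what is left of first order is \<open>- R_lP\<close>.\<close>

lemma sum_column_bound:
  assumes fin: "finite (set_pmf P)" and P: "set_pmf P \<subseteq> {0<..<1}" and l: "l \<ge> 1"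
  shows "(\<Sum>x\<le>l. real (l choose x) * column_bound P b \<rho> l x)
    = 1 - b * R_lP P l + b\<^sup>2 * \<rho> * real l"
proof -
  let ?E = "measure_pmf.expectation P"
  have int [simp]: "integrable (measure_pmf P) f" for f :: "real \<Rightarrow> real"
    using fin by (rule integrable_measure_pmf_finite)
  have swap: "(\<Sum>x\<le>l. real (l choose x) * ?E (F x)) = ?E (\<lambda>q. \<Sum>x\<le>l. real (l choose x) * F x q)" for F
    by simp
  have const: "?E F = a" if "\<And>q. 0 < q \<Longrightarrow> q < 1 \<Longrightarrow> F q = a" for F and a :: real
  proof -
    have "?E F = ?E (\<lambda>_. a)"
      using P that by (intro integral_cong_AE) (auto simp: AE_measure_pmf_iff)
    then show ?thesis by simp
  qed
  have w: "(\<Sum>x\<le>l. real (l choose x) * ?E (\<lambda>q. q ^ x * (1 - q) ^ (l - x))) = 1"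
    unfolding swap
  proof (rule const)
    fix q :: real
    show "(\<Sum>x\<le>l. real (l choose x) * (q ^ x * (1 - q) ^ (l - x))) = 1"
      using sum_Bernstein[of l q] by (simp add: Bernstein_def mult.assoc)
  qed
  have v: "(\<Sum>x\<le>l. real (l choose x) * ?E (\<lambda>q. q ^ x * (1 - q) ^ (l - x) * (coalition_score l x q)\<^sup>2)) = real l"
    unfolding swap
  proof (rule const)
    fix q :: real assume "0 < q" "q < 1"
    then show "(\<Sum>x\<le>l. real (l choose x) * (q ^ x * (1 - q) ^ (l - x) * (coalition_score l x q)\<^sup>2)) = real l"
      using sum_Bernstein_coalition_score_square[of q l] by (simp add: Bernstein_def mult.assoc)
  qed
  have e: "(\<Sum>x\<le>l. real (l choose x) * ?E (f_fp l x)) = 0"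
    unfolding swap
  proof (rule const)
    fix q :: real assume "0 < q" "q < 1"
    then show "(\<Sum>x\<le>l. real (l choose x) * f_fp l x q) = 0"
      using sum_Bernstein_coalition_score[of q l]
      by (simp add: Bernstein_def f_fp_coalition_score mult.assoc)
  qed
  have mid: "(\<Sum>x\<le>l. real (l choose x) * (if x \<in> {1..l - 1} then R_lx P l x else 0))
      = (\<Sum>x = 1..l - 1. real (l choose x) * R_lx P l x)"
    by (rule sum.mono_neutral_cong_right) auto
  have zero: "(\<Sum>x\<le>l. real (l choose x) * (if x = 0 then ?E (f_fp l 0) else 0)) = ?E (f_fp l 0)"
    by (subst sum.mono_neutral_cong_right[where S = "{0}" and h = "\<lambda>_. ?E (f_fp l 0)"]) auto
  have "(\<Sum>x\<le>l. real (l choose x) * column_bound P b \<rho> l x)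
    = (\<Sum>x\<le>l. real (l choose x) * ?E (\<lambda>q. q ^ x * (1 - q) ^ (l - x)))
      + b\<^sup>2 * \<rho> * (\<Sum>x\<le>l. real (l choose x) * ?E (\<lambda>q. q ^ x * (1 - q) ^ (l - x) * (coalition_score l x q)\<^sup>2))
      + b * ((\<Sum>x\<le>l. real (l choose x) * (if x \<in> {1..l - 1} then R_lx P l x else 0))
            - (\<Sum>x\<le>l. real (l choose x) * ?E (f_fp l x))
            + (\<Sum>x\<le>l. real (l choose x) * (if x = 0 then ?E (f_fp l 0) else 0)))"
    unfolding column_bound_def sum_distrib_left sum.distrib[symmetric] sum_subtractf[symmetric]
    by (intro sum.cong refl) (simp only: algebra_simps)
  also have "\<dots> = 1 - b * R_lP P l + b\<^sup>2 * \<rho> * real l"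
    unfolding w v e mid zero by (simp add: R_lP_def algebra_simps)
  finally show ?thesis .
qed

text \<open>The assumptions \<open>one\<close> and \<open>zero\<close> are the Marking Assumption.
  Output 1 has first-order term \<open>- E f\<close>, any other output has 0. For
  \<open>0 < x < l\<close> both are at most \<open>R_lx - E f\<close>, the positive part of
  \<open>- E f\<close>; at the ends the forced output matches the bound.\<close>

lemma column_bound_ge:
  assumes fin: "finite (set_pmf P)" and P: "set_pmf P \<subseteq> {0<..<1}" and xl: "x \<le> l"
    and b: "0 < b" and t: "0 < t" "\<And>q. q \<in> set_pmf P \<Longrightarrow> b * real l * sigma_fp (1 - q) \<le> t"
    and one: "x = l \<Longrightarrow> s = Some True" and zero: "x = 0 \<Longrightarrow> s = Some False"
  shows "measure_pmf.expectation P (\<lambda>q. q ^ x * (1 - q) ^ (l - x)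
      * exp (- b * (if s = Some True then coalition_score l x q else 0)))
    \<le> column_bound P b (r_fun t) l x"
proof -
  let ?E = "measure_pmf.expectation P"
  let ?w = "\<lambda>q::real. q ^ x * (1 - q) ^ (l - x)"
  let ?g = "coalition_score l x"
  have int [simp]: "integrable (measure_pmf P) f" for f :: "real \<Rightarrow> real"
    using fin by (rule integrable_measure_pmf_finite)
  have \<rho>: "r_fun t \<ge> 0" using r_fun_ge_half[OF t(1)] by simp
  have sq: "0 \<le> ?E (\<lambda>q. ?w q * (?g q)\<^sup>2)"
    using P by (intro integral_nonneg_AE) (auto simp: AE_measure_pmf_iff)
  then have sq': "0 \<le> b\<^sup>2 * r_fun t * ?E (\<lambda>q. ?w q * (?g q)\<^sup>2)" using \<rho> by simp
  show ?thesis
  proof (cases "s = Some True")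
    case True
    then have x0: "x \<noteq> 0" using zero by auto
    have "?E (\<lambda>q. ?w q * exp (- b * ?g q))
        \<le> ?E (\<lambda>q. ?w q + b\<^sup>2 * r_fun t * (?w q * (?g q)\<^sup>2) - b * f_fp l x q)"
    proof (intro integral_mono_AE int, unfold AE_measure_pmf_iff, rule ballI)
      fix q assume q: "q \<in> set_pmf P"
      then have q01: "0 < q" "q < 1" using P by auto
      \<comment> \<open>Only an upper bound on the exponent is needed, and it becomes positive only
        through the pirates holding a 0.\<close>
      have "- ?g q \<le> real (l - x) * sigma_fp (1 - q)"
        using sigma_fp_pos[OF q01] by (simp add: coalition_score_def)
      also have "\<dots> \<le> real l * sigma_fp (1 - q)"
        using sigma_fp_pos[of "1 - q"] q01 by (intro mult_right_mono) auto
      finally have "b * - ?g q \<le> b * (real l * sigma_fp (1 - q))"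
        using b by (intro mult_left_mono) auto
      then have "- b * ?g q \<le> t" using t(2)[OF q] by (simp add: mult.assoc)
      then have "exp (- b * ?g q) \<le> 1 + (- b * ?g q) + (- b * ?g q)\<^sup>2 * r_fun t"
        by (intro exp_le_quadratic_r_fun t)
      then have "?w q * exp (- b * ?g q)
          \<le> ?w q * (1 + (- b * ?g q) + (- b * ?g q)\<^sup>2 * r_fun t)"
        using q01 by (intro mult_left_mono) auto
      also have "\<dots> = ?w q + b\<^sup>2 * r_fun t * (?w q * (?g q)\<^sup>2) - b * f_fp l x q"
        unfolding f_fp_coalition_score by (simp add: algebra_simps power2_eq_square)
      finally show "?w q * exp (- b * ?g q)
          \<le> ?w q + b\<^sup>2 * r_fun t * (?w q * (?g q)\<^sup>2) - b * f_fp l x q" .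
    qed
    also have "\<dots> = ?E ?w + b\<^sup>2 * r_fun t * ?E (\<lambda>q. ?w q * (?g q)\<^sup>2) - b * ?E (f_fp l x)"
      by simp
    also have "\<dots> \<le> column_bound P b (r_fun t) l x"
      using x0 b by (auto simp: column_bound_def R_lx_def algebra_simps)
    finally show ?thesis using True by simp
  next
    case False
    \<comment> \<open>With \<open>x = l\<close> the output 1 would be forced. With
      \<open>x = 0\<close> the two expectations of \<open>f_fp l 0\<close> cancel.\<close>
    then have "x < l" using one xl by (cases "x = l") auto
    then have "0 \<le> b * ((if x \<in> {1..l - 1} then R_lx P l x else 0) - ?E (f_fp l x)
        + (if x = 0 then ?E (f_fp l 0) else 0))"
      using b by (auto simp: R_lx_def)
    then show ?thesis using False sq' by (simp add: column_bound_def)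
  qed
qed

section \<open>The order of the experiment and false positives\<close>

text \<open>Supplies the strictness of both final error bounds.\<close>

lemma one_plus_power_less_exp:
  fixes z :: real
  assumes "z \<noteq> 0" "0 \<le> 1 + z" "0 < m"
  shows "(1 + z) ^ m < exp (real m * z)"
  using power_strict_mono[of "1 + z" "exp z" m] exp_minus_greater[of "- z"] assms
  by (simp add: exp_of_nat_mult)

text \<open>The strategy reads only the pirates' rows, so the remaining rows can be drawn after the
  pirated word. Given the biases they are then visibly independent of it.\<close>

lemma scheme_experiment_innocents_last:
  assumes T: "T \<subseteq> {..<N}"
  shows "scheme_experiment P N m T strat =
    do { pv \<leftarrow> Pi_pmf {..<m} (1/2) (\<lambda>_. P);
         f \<leftarrow> Pi_pmf T (\<lambda>_. False) (\<lambda>_. Pi_pmf {..<m} False (\<lambda>j. bernoulli_pmf (pv j)));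
         y \<leftarrow> strat (pirate_view T m f);
         g \<leftarrow> Pi_pmf ({..<N} - T) (\<lambda>_. False) (\<lambda>_. Pi_pmf {..<m} False (\<lambda>j. bernoulli_pmf (pv j)));
         return_pmf (pv, (\<lambda>i. if i \<in> T then f i else g i), y) }"
proof -
  have fin: "finite T" using T finite_subset by blast
  have view: "pirate_view T m (\<lambda>i. if i \<in> T then f i else g i) = pirate_view T m f"
    for f g :: "nat \<Rightarrow> nat \<Rightarrow> bool"
    by (auto simp: pirate_view_def fun_eq_iff)
  have split: "Pi_pmf {..<N} d q = map_pmf (\<lambda>(f, g) i. if i \<in> T then f i else g i)
      (pair_pmf (Pi_pmf T d q) (Pi_pmf ({..<N} - T) d q))" for d :: "nat \<Rightarrow> bool" and q
    using Pi_pmf_union[of T "{..<N} - T" d q] fin T by (simp add: Un_absorb1)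
  show ?thesis
    unfolding scheme_experiment_def split
    by (simp add: pair_pmf_def map_pmf_def bind_assoc_pmf bind_return_pmf view
        bind_commute_pmf[of "Pi_pmf ({..<N} - T) _ _"])
qed

text \<open>Each position contributes an error of at most \<delta>. For a bit 0 this uses that
  \<open>U (k - \<nu>)\<close> approximates \<open>sigma_fp\<close> at
  \<open>p (k - \<nu>) = 1 - p \<nu>\<close>.\<close>

lemma approx_score_error:
  assumes inj: "inj_on p {..k}" and refl: "\<And>i. i \<le> k \<Longrightarrow> p (k - i) = 1 - p i"
    and U: "\<forall>i\<le>k. \<bar>U i - sigma_fp (p i)\<bar> \<le> \<delta>" and \<delta>: "0 \<le> \<delta>"
    and pv: "\<And>j. j < m \<Longrightarrow> pv j \<in> p ` {..k}"
  shows "\<bar>approx_score p k U m pv w y i - (\<Sum>j<m. user_score (pv j) (w i j) (y j))\<bar> \<le> real m * \<delta>"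
proof -
  let ?t = "\<lambda>j. case y j of
                Some True \<Rightarrow> (if w i j then U (bias_index p k (pv j))
                              else - U (k - bias_index p k (pv j)))
              | _ \<Rightarrow> 0"
  have "\<bar>approx_score p k U m pv w y i - (\<Sum>j<m. user_score (pv j) (w i j) (y j))\<bar>
      \<le> (\<Sum>j<m. \<bar>?t j - user_score (pv j) (w i j) (y j)\<bar>)"
    unfolding approx_score_def sum_subtractf[symmetric] by (rule sum_abs)
  also have "\<dots> \<le> (\<Sum>j<m. \<delta>)"
  proof (rule sum_mono)
    fix j assume "j \<in> {..<m}"
    then obtain \<nu> where \<nu>: "\<nu> \<le> k" "pv j = p \<nu>" using pv[of j] by auto
    have "bias_index p k (pv j) = \<nu>"
      unfolding bias_index_def using \<nu> inj by (intro the_equality) (auto dest: inj_onD)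
    moreover have "\<bar>U \<nu> - sigma_fp (p \<nu>)\<bar> \<le> \<delta>" using U \<nu> by blast
    moreover have "\<bar>U (k - \<nu>) - sigma_fp (1 - p \<nu>)\<bar> \<le> \<delta>"
      using U[rule_format, of "k - \<nu>"] refl[OF \<nu>(1)] by simp
    ultimately show "\<bar>?t j - user_score (pv j) (w i j) (y j)\<bar> \<le> \<delta>"
      using \<delta> by (auto simp: user_score_def \<nu>(2) split: option.split bool.split)
  qed
  finally show ?thesis by simp
qed

text \<open>Once biases, pirates' rows and pirated word are fixed, the innocent rows are
  independent. Each one reaches the lowered threshold \<open>Z - m * \<delta>\<close> with
  probability at most \<open>e\<close>, hence all stay below it with probability at least
  \<open>1 - e\<close> to the number of innocents.\<close>

lemma false_positive_prob_le:
  assumes inj: "inj_on p {..k}" and refl: "\<And>i. i \<le> k \<Longrightarrow> p (k - i) = 1 - p i"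
    and supp: "set_pmf P = p ` {..k}" and P: "set_pmf P \<subseteq> {0<..<1}"
    and U: "\<forall>i\<le>k. \<bar>U i - sigma_fp (p i)\<bar> \<le> \<delta>" and \<delta>: "0 \<le> \<delta>"
    and a: "0 < a" "0 < x" "\<And>q. q \<in> set_pmf P \<Longrightarrow> a * sigma_fp q \<le> x"
    and T: "T \<subseteq> {..<N}"
    and e: "exp (- a * (Z - real m * \<delta>)) * (1 + a\<^sup>2 * r_fun x) ^ m \<le> e" "e \<le> 1"
  shows "measure_pmf.prob (scheme_experiment P N m T strat) (false_positive p k U N m T Z)
    \<le> 1 - (1 - e) ^ card ({..<N} - T)"
proof -
  let ?I = "{..<N} - T"
  have "1 + a\<^sup>2 * r_fun x \<ge> 0" using r_fun_ge_half[OF a(2)] by simp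
  then have "0 \<le> exp (- a * (Z - real m * \<delta>)) * (1 + a\<^sup>2 * r_fun x) ^ m" by simp
  then have e0: "0 \<le> e" using e by linarith
  have B: "0 \<le> 1 - (1 - e) ^ card ?I" using e e0 by (simp add: power_le_one)
  show ?thesis
    unfolding scheme_experiment_innocents_last[OF T] map_pmf_def[symmetric]
  proof (intro prob_bind_pmf_le B)
    fix pv :: "nat \<Rightarrow> real" and f :: "nat \<Rightarrow> nat \<Rightarrow> bool" and y :: "nat \<Rightarrow> bool option"
    assume "pv \<in> set_pmf (Pi_pmf {..<m} (1 / 2) (\<lambda>_. P))"
    then have pv: "\<And>j. j < m \<Longrightarrow> pv j \<in> set_pmf P"
      by (auto simp: set_Pi_pmf PiE_dflt_def)
    let ?C = "Pi_pmf {..<m} False (\<lambda>j. bernoulli_pmf (pv j))"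
    let ?M = "Pi_pmf ?I (\<lambda>_. False) (\<lambda>_. ?C)"
    let ?bad = "{h. Z - real m * \<delta> \<le> (\<Sum>j<m. user_score (pv j) (h j) (y j))}"
    let ?w = "\<lambda>g i. if i \<in> T then f i else g i"
    have tail: "measure_pmf.prob ?C ?bad \<le> e"
      using innocent_score_tail[of m pv a x "Z - real m * \<delta>" y] a P pv e(1) by fastforce
    have "measure_pmf.prob (map_pmf (\<lambda>g. (pv, ?w g, y)) ?M) (false_positive p k U N m T Z)
        = measure_pmf.prob ?M ((\<lambda>g. (pv, ?w g, y)) -` false_positive p k U N m T Z)"
      by simp
    also have "\<dots> \<le> measure_pmf.prob ?M (UNIV - Pi ?I (\<lambda>_. UNIV - ?bad))"
    proof (intro measure_pmf.finite_measure_mono subsetI)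
      fix g assume "g \<in> (\<lambda>g. (pv, ?w g, y)) -` false_positive p k U N m T Z"
      then obtain i where i: "i \<in> ?I" "Z \<le> approx_score p k U m pv (?w g) y i"
        by (auto simp: false_positive_def)
      then have "Z - real m * \<delta> \<le> (\<Sum>j<m. user_score (pv j) (g i j) (y j))"
        using approx_score_error[where m = m and pv = pv and w = "?w g" and y = y and i = i,
            OF inj refl U \<delta> pv[unfolded supp]]
        by (auto simp: abs_le_iff)
      then show "g \<in> UNIV - Pi ?I (\<lambda>_. UNIV - ?bad)" using i by auto
    qed simp
    also have "\<dots> = 1 - (\<Prod>i\<in>?I. measure_pmf.prob ?C (UNIV - ?bad))"
      using measure_pmf.prob_compl[of "Pi ?I (\<lambda>_. UNIV - ?bad)" ?M] by (simp add: measure_Pi_pmf_Pi)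
    also have "\<dots> = 1 - (1 - measure_pmf.prob ?C ?bad) ^ card ?I"
      using measure_pmf.prob_compl[of ?bad ?C] by simp
    also have "\<dots> \<le> 1 - (1 - e) ^ card ?I"
      using tail e e0 by (intro diff_left_mono power_mono) auto
    finally show "measure_pmf.prob (map_pmf (\<lambda>g. (pv, ?w g, y)) ?M)
        (false_positive p k U N m T Z) \<le> 1 - (1 - e) ^ card ?I" .
  qed
qed

section \<open>False negatives\<close>

lemma column_bound_nonneg:
  assumes "finite (set_pmf P)" "set_pmf P \<subseteq> {0<..<1}" "x \<le> l" "1 \<le> l"
    and "0 < b" "0 < t" "\<And>q. q \<in> set_pmf P \<Longrightarrow> b * real l * sigma_fp (1 - q) \<le> t"
  shows "0 \<le> column_bound P b (r_fun t) l x"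
proof -
  \<comment> \<open>The symbol \<open>Some (x = l)\<close> is admissible in both forced cases: since
    \<open>l \<ge> 1\<close>, it is \<open>Some False\<close> at \<open>x = 0\<close>.\<close>
  have "0 \<le> measure_pmf.expectation P (\<lambda>q. q ^ x * (1 - q) ^ (l - x)
      * exp (- b * (if Some (x = l) = Some True then coalition_score l x q else 0)))"
    using assms(2) by (intro integral_nonneg_AE) (auto simp: AE_measure_pmf_iff)
  also have "\<dots> \<le> column_bound P b (r_fun t) l x"
    using assms by (intro column_bound_ge) auto
  finally show ?thesis .
qed

lemma column_factor_nonneg:
  assumes "finite (set_pmf P)" "set_pmf P \<subseteq> {0<..<1}" "1 \<le> l"
    and "0 < b" "0 < t" "\<And>q. q \<in> set_pmf P \<Longrightarrow> b * real l * sigma_fp (1 - q) \<le> t"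
  shows "0 \<le> 1 - b * R_lP P l + b\<^sup>2 * r_fun t * real l"
proof -
  have "0 \<le> (\<Sum>x\<le>l. real (l choose x) * column_bound P b (r_fun t) l x)"
    using assms by (intro sum_nonneg mult_nonneg_nonneg column_bound_nonneg) auto
  then show ?thesis using sum_column_bound[OF assms(1-3)] by simp
qed

text \<open>Applies \<open>adversarial_product_bound\<close> to the columns of the pirates' matrix,
  with the Marking Assumption as admissibility. Grouping columns by their number of ones then
  evaluates the base of the power.\<close>

lemma coalition_mgf_le:
  assumes fin: "finite (set_pmf P)" and P: "set_pmf P \<subseteq> {0<..<1}"
    and T: "finite T" "1 \<le> card T"
    and b: "0 < b" "0 < t" "\<And>q. q \<in> set_pmf P \<Longrightarrow> b * real (card T) * sigma_fp (1 - q) \<le> t"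
    and mark: "marking_assumption T m strat"
  shows "(\<integral>\<^sup>+pv. \<integral>\<^sup>+f. \<integral>\<^sup>+y. (\<Prod>j<m. ennreal (exp (- b * (\<Sum>i\<in>T. user_score (pv j) (f i j) (y j)))))
      \<partial>strat (pirate_view T m f)
      \<partial>Pi_pmf T (\<lambda>_. False) (\<lambda>_. Pi_pmf {..<m} False (\<lambda>j. bernoulli_pmf (pv j)))
      \<partial>Pi_pmf {..<m} (1 / 2) (\<lambda>_. P))
    \<le> ennreal ((1 - b * R_lP P (card T) + b\<^sup>2 * r_fun t * real (card T)) ^ m)"
proof -
  let ?l = "card T"
  let ?V = "PiE_dflt T False (\<lambda>_. UNIV :: bool set)"
  let ?x = "\<lambda>v. card {i \<in> T. v i}"
  let ?M = "\<lambda>v. ennreal (column_bound P b (r_fun t) ?l (?x v))"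
  let ?adm = "\<lambda>v s. \<forall>c. (\<forall>i\<in>T. v i = c) \<longrightarrow> s = Some c"
  let ?h = "\<lambda>q v s. ennreal (exp (- b * (\<Sum>i\<in>T. user_score q (v i) s)))"
  have nonneg: "0 \<le> column_bound P b (r_fun t) ?l x" if "x \<le> ?l" for x
    using assms that by (intro column_bound_nonneg) auto
  have xl: "?x v \<le> ?l" for v using T by (intro card_mono) auto
  have "(\<integral>\<^sup>+pv. \<integral>\<^sup>+f. \<integral>\<^sup>+y. (\<Prod>j<m. ennreal (exp (- b * (\<Sum>i\<in>T. user_score (pv j) (f i j) (y j)))))
      \<partial>strat (pirate_view T m f)
      \<partial>Pi_pmf T (\<lambda>_. False) (\<lambda>_. Pi_pmf {..<m} False (\<lambda>j. bernoulli_pmf (pv j)))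
      \<partial>Pi_pmf {..<m} (1 / 2) (\<lambda>_. P))
    = (\<integral>\<^sup>+pv. \<integral>\<^sup>+v. \<integral>\<^sup>+y. (\<Prod>j<m. ?h (pv j) (v j) (y j))
      \<partial>strat (pirate_view T m (\<lambda>i j. v j i))
      \<partial>Pi_pmf {..<m} (\<lambda>_. False) (\<lambda>j. Pi_pmf T False (\<lambda>_. bernoulli_pmf (pv j)))
      \<partial>Pi_pmf {..<m} (1 / 2) (\<lambda>_. P))"
    using T by (subst Pi_pmf_transpose) simp_all
  also have "\<dots> \<le> (\<Sum>v\<in>?V. ?M v) ^ card {..<m}"
  proof (rule adversarial_product_bound[where adm = ?adm and h = ?h
        and Q = "\<lambda>q. Pi_pmf T False (\<lambda>_. bernoulli_pmf q)"
        and S = "\<lambda>v. strat (pirate_view T m (\<lambda>i j. v j i))"])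
    show "finite ?V" using T by (intro finite_PiE_dflt) auto
    show "set_pmf (Pi_pmf T False (\<lambda>_. bernoulli_pmf q)) \<subseteq> ?V" for q
      using T by (auto simp: set_Pi_pmf PiE_dflt_def)
    show "?adm (v j) (y j)"
      if "y \<in> set_pmf (strat (pirate_view T m (\<lambda>i j. v j i)))" "j \<in> {..<m}" for v y j
      using mark that unfolding marking_assumption_def by (auto simp: pirate_view_def)
  next
    fix v s assume v: "v \<in> ?V" and adm: "?adm v s"
    have one: "s = Some True" if "?x v = ?l"
    proof -
      have "{i \<in> T. v i} = T" using T that by (intro card_subset_eq) auto
      then show ?thesis using adm by blast
    qed
    have zero: "s = Some False" if "?x v = 0"
      using that T adm by auto
    let ?F = "\<lambda>q. q ^ ?x v * (1 - q) ^ (?l - ?x v)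
        * exp (- b * (if s = Some True then coalition_score ?l (?x v) q else 0))"
    have "(\<integral>\<^sup>+q. ennreal (pmf (Pi_pmf T False (\<lambda>_. bernoulli_pmf q)) v) * ?h q v s \<partial>P)
        = (\<integral>\<^sup>+q. ennreal (?F q) \<partial>P)"
    proof (intro nn_integral_cong_AE, unfold AE_measure_pmf_iff, rule ballI)
      fix q assume "q \<in> set_pmf P"
      then have "0 < q" "q < 1" using P by auto
      then show "ennreal (pmf (Pi_pmf T False (\<lambda>_. bernoulli_pmf q)) v) * ?h q v s = ennreal (?F q)"
        using T v by (subst pmf_Pi_bernoulli) (auto simp: sum_user_score_coalition ennreal_mult)
    qed
    also have "\<dots> = ennreal (measure_pmf.expectation P ?F)"
      using P fin by (intro nn_integral_eq_integral integrable_measure_pmf_finite)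
        (auto simp: AE_measure_pmf_iff)
    also have "\<dots> \<le> ?M v"
      using assms one zero xl by (intro ennreal_leI column_bound_ge) auto
    finally show "(\<integral>\<^sup>+q. ennreal (pmf (Pi_pmf T False (\<lambda>_. bernoulli_pmf q)) v) * ?h q v s \<partial>P) \<le> ?M v" .
  qed simp
  also have "(\<Sum>v\<in>?V. ?M v) = ennreal (\<Sum>v\<in>?V. column_bound P b (r_fun t) ?l (?x v))"
    using nonneg xl by (simp add: sum_ennreal)
  also have "(\<Sum>v\<in>?V. column_bound P b (r_fun t) ?l (?x v))
      = 1 - b * R_lP P ?l + b\<^sup>2 * r_fun t * real ?l"
    using sum_column_bound[OF fin P T(2)] by (simp add: sum_PiE_dflt_bool_card[OF T(1)])
  also have "ennreal \<dots> ^ card {..<m} = ennreal ((1 - b * R_lP P ?l + b\<^sup>2 * r_fun t * real ?l) ^ m)"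
    using column_factor_nonneg[OF fin P T(2) b] by (simp add: ennreal_power)
  finally show ?thesis .
qed

text \<open>If no pirate is output, the exact scores of the coalition sum to at most
  \<open>card T * (Z + m * \<delta>)\<close>; Markov's inequality is applied to the exponential of
  \<open>b\<close> times the deficit.\<close>

lemma false_negative_prob_le:
  assumes inj: "inj_on p {..k}" and refl: "\<And>i. i \<le> k \<Longrightarrow> p (k - i) = 1 - p i"
    and supp: "set_pmf P = p ` {..k}" and P: "set_pmf P \<subseteq> {0<..<1}"
    and U: "\<forall>i\<le>k. \<bar>U i - sigma_fp (p i)\<bar> \<le> \<delta>" and \<delta>: "0 \<le> \<delta>"
    and T: "T \<subseteq> {..<N}" "1 \<le> card T"
    and b: "0 < b" "0 < t" "\<And>q. q \<in> set_pmf P \<Longrightarrow> b * real (card T) * sigma_fp (1 - q) \<le> t"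
    and mark: "marking_assumption T m strat"
  shows "measure_pmf.prob (scheme_experiment P N m T strat) (false_negative p k U m T Z)
    \<le> exp (b * real (card T) * (Z + real m * \<delta>))
      * (1 - b * R_lP P (card T) + b\<^sup>2 * r_fun t * real (card T)) ^ m"
proof -
  let ?l = "real (card T)"
  let ?c = "exp (b * ?l * (Z + real m * \<delta>))"
  let ?K = "1 - b * R_lP P (card T) + b\<^sup>2 * r_fun t * ?l"
  let ?S = "\<lambda>pv w y j. exp (- b * (\<Sum>i\<in>T. user_score (pv j) (w i j) (y j)))"
  have fin: "finite (set_pmf P)" unfolding supp by simp
  have finT: "finite T" using T finite_subset by blast
  have K: "0 \<le> ?K" using column_factor_nonneg[OF fin P T(2) b] .
  have "ennreal (measure_pmf.prob (scheme_experiment P N m T strat) (false_negative p k U m T Z))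
      \<le> (\<integral>\<^sup>+z. (case z of (pv, w, y) \<Rightarrow> ennreal ?c * (\<Prod>j<m. ennreal (?S pv w y j)))
          \<partial>scheme_experiment P N m T strat)"
  proof (rule prob_le_nn_integral_pmf, clarify)
    fix pv w y
    assume mem: "(pv, w, y) \<in> set_pmf (scheme_experiment P N m T strat)"
      and fn: "(pv, w, y) \<in> false_negative p k U m T Z"
    have pv: "pv j \<in> p ` {..k}" if "j < m" for j
      using mem that supp by (auto simp: scheme_experiment_def set_Pi_pmf PiE_dflt_def)
    have "(\<Sum>i\<in>T. \<Sum>j<m. user_score (pv j) (w i j) (y j)) \<le> (\<Sum>i\<in>T. Z + real m * \<delta>)"
    proof (rule sum_mono)
      fix i assume "i \<in> T"
      then have "approx_score p k U m pv w y i < Z" using fn by (auto simp: false_negative_def)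
      then show "(\<Sum>j<m. user_score (pv j) (w i j) (y j)) \<le> Z + real m * \<delta>"
        using approx_score_error[where m = m and pv = pv and w = w and y = y and i = i, OF inj refl U \<delta> pv]
        by (auto simp: abs_le_iff)
    qed
    then have "b * (\<Sum>j<m. \<Sum>i\<in>T. user_score (pv j) (w i j) (y j)) \<le> b * (?l * (Z + real m * \<delta>))"
      using b by (subst sum.swap) (auto intro!: mult_left_mono)
    then have "1 \<le> exp (b * ?l * (Z + real m * \<delta>) + (\<Sum>j<m. - b * (\<Sum>i\<in>T. user_score (pv j) (w i j) (y j))))"
      by (simp add: sum_negf sum_distrib_left[symmetric] mult.assoc)
    also have "\<dots> = ?c * (\<Prod>j<m. ?S pv w y j)"
      by (simp only: exp_add exp_sum[OF finite_lessThan])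
    finally show "1 \<le> ennreal ?c * (\<Prod>j<m. ennreal (?S pv w y j))"
      by (simp add: prod_ennreal ennreal_mult[symmetric] prod_nonneg)
  qed
  \<comment> \<open>The integrand reads only rows in \<open>T\<close>, which are those of
    \<open>f\<close>, so the innocent rows integrate to 1.\<close>
  also have "\<dots> = (\<integral>\<^sup>+pv. \<integral>\<^sup>+f. \<integral>\<^sup>+y. ennreal ?c * (\<Prod>j<m. ennreal (?S pv f y j))
      \<partial>strat (pirate_view T m f)
      \<partial>Pi_pmf T (\<lambda>_. False) (\<lambda>_. Pi_pmf {..<m} False (\<lambda>j. bernoulli_pmf (pv j)))
      \<partial>Pi_pmf {..<m} (1 / 2) (\<lambda>_. P))"
    unfolding scheme_experiment_innocents_last[OF T(1)] by (simp cong: sum.cong)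
  also have "\<dots> = ennreal ?c * (\<integral>\<^sup>+pv. \<integral>\<^sup>+f. \<integral>\<^sup>+y. (\<Prod>j<m. ennreal (?S pv f y j))
      \<partial>strat (pirate_view T m f)
      \<partial>Pi_pmf T (\<lambda>_. False) (\<lambda>_. Pi_pmf {..<m} False (\<lambda>j. bernoulli_pmf (pv j)))
      \<partial>Pi_pmf {..<m} (1 / 2) (\<lambda>_. P))"
    by (simp add: nn_integral_cmult)
  also have "\<dots> \<le> ennreal ?c * ennreal (?K ^ m)"
    by (intro mult_left_mono coalition_mgf_le fin P finT T b mark) simp_all
  also have "\<dots> = ennreal (?c * ?K ^ m)" using K by (simp add: ennreal_mult)
  finally show ?thesis using K by simp
qed

section \<open>Choice of the Chernoff exponents and evaluation at the threshold\<close>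

theorem theorem4:
  fixes c N k m :: nat and P :: "real pmf" and p U :: "nat \<Rightarrow> real"
    and \<delta> R \<psi>1 \<psi>2 \<eta>1 \<eta>2 x1 x2 \<epsilon>1 \<epsilon>2 A1 A2 D Z :: real
  assumes c: "c \<ge> 1" and N: "N \<ge> 2"
    and P: "finite_bias_dist P"
    and p_mono: "strict_mono_on {..k} p" and p_supp: "set_pmf P = p ` {..k}"
    and \<delta>: "\<delta> \<ge> 0" and U: "\<forall>i\<le>k. \<bar>U i - sigma_fp (p i)\<bar> \<le> \<delta>"
    and R: "R > 0" "\<forall>l\<in>{1..c}. R \<le> R_lP P l"
    and \<psi>: "\<psi>1 > 0" "\<psi>2 > 0" "\<psi>1 \<le> sigma_fp (p 0)" "sigma_fp (p 0) \<le> \<psi>2"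
    and \<eta>: "\<eta>1 > 0" "\<eta>2 > 0"
    and x: "x1 > 0" "x2 > 0"
      "x1 * r_fun x1 \<le> \<eta>1 * R * \<psi>1 / real c"
      "x2 * r_fun x2 \<le> \<eta>2 * R * \<psi>1 / real c"
    and \<epsilon>: "0 < \<epsilon>1" "\<epsilon>1 < 1" "0 < \<epsilon>2" "\<epsilon>2 < 1"
    and D_def: "D = (1 - \<eta>1 - \<eta>2 / real c) * R - 2 * \<delta> * real c" and D: "D > 0"
    and A: "A1 \<ge> real c / D * (\<psi>2 / x1) * ln (1 / \<epsilon>1)"
           "A2 \<ge> real c / D * (\<psi>2 / x2) * ln (1 / \<epsilon>2)"
    and m: "m > 0" "real m = A1 + A2"
    and Z_def: "Z = ((1 - \<eta>2 / real c) * R / real c - \<delta>) * A1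
                   + (\<eta>1 * R / real c + \<delta>) * A2"
  shows "\<forall>l T strat. 1 \<le> l \<and> l \<le> c \<and> T \<subseteq> {..<N} \<and> card T = l
           \<and> marking_assumption T m strat \<longrightarrow>
           measure_pmf.prob (scheme_experiment P N m T strat) (false_positive p k U N m T Z)
              < 1 - (1 - \<epsilon>1) ^ (N - 1)
         \<and> 1 - (1 - \<epsilon>1) ^ (N - 1) \<le> real (N - 1) * \<epsilon>1
         \<and> measure_pmf.prob (scheme_experiment P N m T strat) (false_negative p k U m T Z)
              < \<epsilon>2
         \<and> measure_pmf.prob (scheme_experiment P N m T strat)
              (false_positive p k U N m T Z \<union> false_negative p k U m T Z)
              \<le> real (N - 1) * \<epsilon>1 + \<epsilon>2"
proof (intro allI impI)
  fix l T strat
  assume H: "1 \<le> l \<and> l \<le> c \<and> T \<subseteq> {..<N} \<and> card T = l \<and> marking_assumption T m strat"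
  then have l: "1 \<le> l" "l \<le> c" and T: "T \<subseteq> {..<N}" "card T = l"
    and mark: "marking_assumption T m strat" by auto
  let ?E = "scheme_experiment P N m T strat"
  let ?FP = "false_positive p k U N m T Z" and ?FN = "false_negative p k U m T Z"
  have supp01: "set_pmf P \<subseteq> {0<..<1}" and fin: "finite (set_pmf P)"
    and sym: "\<And>q. pmf P (1 - q) = pmf P q" using P by (auto simp: finite_bias_dist_def)
  have sym_supp: "1 - q \<in> set_pmf P" if "q \<in> set_pmf P" for q
    using that sym[of q] by (simp add: set_pmf_iff)
  have refl: "p (k - i) = 1 - p i" if "i \<le> k" for i
    using symmetric_enumeration_reflect[OF p_mono p_supp sym_supp that] .
  have inj: "inj_on p {..k}" using p_mono by (rule strict_mono_on_imp_inj_on)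
  have \<sigma>_le: "sigma_fp q \<le> \<psi>2" if "q \<in> set_pmf P" for q
  proof -
    obtain i where i: "i \<le> k" "q = p i" using \<open>q \<in> set_pmf P\<close> p_supp by auto
    have "p 0 \<le> q"
      using i strict_mono_on_leD[OF p_mono, of 0 i] by simp
    moreover have "p 0 \<in> set_pmf P" using p_supp by auto
    ultimately have "sigma_fp q \<le> sigma_fp (p 0)"
      using supp01 that by (intro sigma_fp_antimono) auto
    then show ?thesis using \<psi> by simp
  qed
  have cpos: "real c > 0" using c by simp
  \<comment> \<open>Second-order cost per position at exponent \<open>x / \<psi>2\<close>; the
    passage from \<psi>1 to \<psi>2 uses \<open>\<psi>1 \<le> \<psi>2\<close>.\<close>
  have rate: "x * r_fun x / \<psi>2 \<le> \<eta> * R / real c"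
    if "0 < \<eta>" "x * r_fun x \<le> \<eta> * R * \<psi>1 / real c" for \<eta> x
  proof -
    have "x * r_fun x \<le> \<eta> * R / real c * \<psi>1" using that by simp
    also have "\<dots> \<le> \<eta> * R / real c * \<psi>2"
      using that R \<psi> cpos by (intro mult_left_mono) auto
    finally show ?thesis using \<psi> by (simp add: pos_divide_le_eq)
  qed
  have gain: "ln (1 / \<epsilon>) \<le> x / \<psi>2 * (A * D / real c)"
    if "0 < x" "real c / D * (\<psi>2 / x) * ln (1 / \<epsilon>) \<le> A" for x A \<epsilon>
  proof -
    have "ln (1 / \<epsilon>) = x / \<psi>2 * (D / real c) * (real c / D * (\<psi>2 / x) * ln (1 / \<epsilon>))"
      using that \<psi> D cpos by simp
    also have "\<dots> \<le> x / \<psi>2 * (D / real c) * A"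
      using that \<psi> D cpos by (intro mult_left_mono) auto
    finally show ?thesis by (simp add: ac_simps)
  qed

  \<comment> \<open>As \<open>sigma_fp \<le> \<psi>2\<close> on the support, this gives
    \<open>a * sigma_fp q \<le> x1\<close>.\<close>
  define a where "a = x1 / \<psi>2"
  define e where "e = exp (- a * (Z - real m * \<delta>)) * (1 + a\<^sup>2 * r_fun x1) ^ m"
  have a: "a > 0" using x \<psi> by (simp add: a_def)
  have r1: "r_fun x1 > 0" using r_fun_ge_half[OF x(1)] by simp
  have e_less: "e < \<epsilon>1"
  proof -
    have "e < exp (- a * (Z - real m * \<delta>)) * exp (real m * (a\<^sup>2 * r_fun x1))"
      unfolding e_def using a r1 m by (intro mult_strict_left_mono one_plus_power_less_exp) auto
    also have "\<dots> = exp (- a * (Z - real m * \<delta> - real m * (a * r_fun x1)))"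
      by (simp add: exp_add[symmetric] algebra_simps power2_eq_square)
    also have "\<dots> \<le> exp (- a * (Z - real m * \<delta> - real m * (\<eta>1 * R / real c)))"
    proof -
      have "a * r_fun x1 \<le> \<eta>1 * R / real c" using rate[OF \<eta>(1) x(3)] by (simp add: a_def)
      then have "real m * (a * r_fun x1) \<le> real m * (\<eta>1 * R / real c)"
        by (rule mult_left_mono) simp
      then show ?thesis using a by (simp del: times_divide_eq_right)
    qed
    \<comment> \<open>The coefficient of \<open>A2\<close> in \<open>Z\<close> equals the cost
      \<open>\<eta>1 * R / c + \<delta>\<close> per position, so \<open>A2\<close> cancels.\<close>
    also have "Z - real m * \<delta> - real m * (\<eta>1 * R / real c) = A1 * D / real c"
      unfolding Z_def m D_def using cpos by (simp add: field_simps)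
    also have "exp (- a * (A1 * D / real c)) \<le> exp (- ln (1 / \<epsilon>1))"
      using gain[OF x(1) A(1)] by (simp add: a_def)
    also have "\<dots> = \<epsilon>1" using \<epsilon> by (simp add: ln_div)
    finally show ?thesis .
  qed
  have e0: "0 \<le> e" using r1 by (simp add: e_def)
  \<comment> \<open>There is at least one pirate.\<close>
  have cardI: "card ({..<N} - T) \<le> N - 1"
    using T l finite_subset[OF T(1)] by (simp add: card_Diff_subset)
  have "measure_pmf.prob ?E ?FP \<le> 1 - (1 - e) ^ card ({..<N} - T)"
    using a x \<epsilon> e_less \<sigma>_le \<psi>
    by (intro false_positive_prob_le[OF inj refl p_supp supp01 U \<delta>, where a = a and x = x1] T)
       (auto simp: a_def e_def pos_divide_le_eq)
  also have "\<dots> \<le> 1 - (1 - e) ^ (N - 1)"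
    using e0 e_less \<epsilon> cardI by (intro diff_left_mono power_decreasing) auto
  also have "\<dots> < 1 - (1 - \<epsilon>1) ^ (N - 1)"
    using e_less \<epsilon> N by (intro diff_strict_left_mono power_strict_mono) auto
  finally have FP: "measure_pmf.prob ?E ?FP < 1 - (1 - \<epsilon>1) ^ (N - 1)" .

  have bernoulli: "1 - (1 - \<epsilon>1) ^ (N - 1) \<le> real (N - 1) * \<epsilon>1"
    using Bernoulli_inequality[of "- \<epsilon>1" "N - 1"] \<epsilon> by simp

  \<comment> \<open>The factor \<open>l\<close> makes \<open>b * l = x2 / \<psi>2\<close>, so
    exponents of the whole coalition stay below \<open>x2\<close>.\<close>
  define b where "b = x2 / (real l * \<psi>2)"
  \<comment> \<open>The first-order gain \<open>b * R\<close> per position minus the bound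
    \<open>b * \<eta>2 * R / c\<close> on the second-order cost.\<close>
  define \<beta> where "\<beta> = b * ((1 - \<eta>2 / real c) * R)"
  define K where "K = 1 - b * R_lP P l + b\<^sup>2 * r_fun x2 * real l"
  have lpos: "real l > 0" using l by simp
  have b: "b > 0" using x \<psi> lpos by (simp add: b_def)
  have bl: "b * real l = x2 / \<psi>2" using lpos by (simp add: b_def)
  have b\<sigma>: "b * real l * sigma_fp (1 - q) \<le> x2" if "q \<in> set_pmf P" for q
    using \<sigma>_le[OF sym_supp[OF that]] x \<psi> by (simp add: bl pos_divide_le_eq)
  \<comment> \<open>The quantity equals \<open>D + \<eta>1 * R + 2 * \<delta> * c\<close>.\<close>
  have drift: "(1 - \<eta>2 / real c) * R > 0"
  proof -
    have "0 \<le> \<eta>1 * R + 2 * \<delta> * real c" using \<eta> R \<delta> by simp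
    then show ?thesis using D unfolding D_def by (simp add: algebra_simps)
  qed
  then have \<beta>: "\<beta> > 0" using b by (simp add: \<beta>_def)
  have K0: "0 \<le> K"
    unfolding K_def using column_factor_nonneg[OF fin supp01 l(1) b x(2) b\<sigma>] .
  have "K \<le> 1 - b * R + b * (x2 * r_fun x2 / \<psi>2)"
  proof -
    have "b\<^sup>2 * r_fun x2 * real l = b * (b * real l * r_fun x2)"
      by (simp add: power2_eq_square)
    also have "\<dots> = b * (x2 * r_fun x2 / \<psi>2)" by (simp add: bl)
    finally show ?thesis using R(2) l b by (simp add: K_def)
  qed
  also have "\<dots> \<le> 1 - b * R + b * (\<eta>2 * R / real c)"
    using b rate[OF \<eta>(2) x(4)] by (intro add_left_mono mult_left_mono) auto
  also have "\<dots> = 1 + - \<beta>" by (simp add: \<beta>_def algebra_simps)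
  finally have K\<beta>: "K \<le> 1 + - \<beta>" .
  have "measure_pmf.prob ?E ?FN \<le> exp (b * real l * (Z + real m * \<delta>)) * K ^ m"
    using false_negative_prob_le[OF inj refl p_supp supp01 U \<delta> T(1) _ b x(2) _ mark] T l b\<sigma>
    by (simp add: K_def)
  also have "\<dots> \<le> exp (b * real l * (Z + real m * \<delta>)) * (1 + - \<beta>) ^ m"
    using K0 K\<beta> by (intro mult_left_mono power_mono) auto
  also have "\<dots> < exp (b * real l * (Z + real m * \<delta>)) * exp (real m * - \<beta>)"
    using \<beta> K0 K\<beta> m by (intro mult_strict_left_mono one_plus_power_less_exp) auto
  also have "\<dots> = exp (b * (real l * (Z + real m * \<delta>) - real m * ((1 - \<eta>2 / real c) * R)))"
    by (simp add: exp_add[symmetric] \<beta>_def algebra_simps)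
  also have "\<dots> \<le> exp (- (x2 / \<psi>2 * (A2 * D / real c)))"
  proof -
    have Z: "Z + real m * \<delta> = real m * ((1 - \<eta>2 / real c) * R) / real c - A2 * D / real c"
      unfolding Z_def m D_def using cpos by (simp add: field_simps)
    \<comment> \<open>Here \<open>l \<le> c\<close> enters: the threshold is set for
      \<open>c\<close> pirates, and a smaller coalition has to stay below a smaller total.\<close>
    have "real l * (real m * ((1 - \<eta>2 / real c) * R) / real c) \<le> real m * ((1 - \<eta>2 / real c) * R)"
    proof -
      have "real l * (real m * ((1 - \<eta>2 / real c) * R)) \<le> real c * (real m * ((1 - \<eta>2 / real c) * R))"
        using l drift by (intro mult_right_mono) auto
      then show ?thesis using cpos by (simp add: pos_divide_le_eq mult.commute)
    qed
    then have "real l * (Z + real m * \<delta>) - real m * ((1 - \<eta>2 / real c) * R) \<le> - (real l * (A2 * D / real c))"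
      unfolding Z by (simp add: right_diff_distrib)
    then have "b * (real l * (Z + real m * \<delta>) - real m * ((1 - \<eta>2 / real c) * R))
        \<le> b * - (real l * (A2 * D / real c))"
      using b by (intro mult_left_mono) auto
    also have "\<dots> = - (x2 / \<psi>2 * (A2 * D / real c))" using bl by (simp add: mult.assoc[symmetric])
    finally show ?thesis by simp
  qed
  also have "\<dots> \<le> exp (- ln (1 / \<epsilon>2))" using gain[OF x(2) A(2)] by simp
  also have "\<dots> = \<epsilon>2" using \<epsilon> by (simp add: ln_div)
  finally have FN: "measure_pmf.prob ?E ?FN < \<epsilon>2" .

  have "measure_pmf.prob ?E (?FP \<union> ?FN) \<le> measure_pmf.prob ?E ?FP + measure_pmf.prob ?E ?FN"
    by (rule measure_Un_le) auto
  then have "measure_pmf.prob ?E (?FP \<union> ?FN) \<le> real (N - 1) * \<epsilon>1 + \<epsilon>2"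
    using FP FN bernoulli by linarith
  then show "measure_pmf.prob ?E ?FP < 1 - (1 - \<epsilon>1) ^ (N - 1)
         \<and> 1 - (1 - \<epsilon>1) ^ (N - 1) \<le> real (N - 1) * \<epsilon>1
         \<and> measure_pmf.prob ?E ?FN < \<epsilon>2
         \<and> measure_pmf.prob ?E (?FP \<union> ?FN) \<le> real (N - 1) * \<epsilon>1 + \<epsilon>2"
    using FP FN bernoulli by blast
qed

end
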